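(* Let $(M,g,A,Q)$ be a weak almost Hermitian manifold with fundamental 2-form $F$, considered as a generalized Riemannian manifold $(M,G=g+F)$. Suppose that $\nabla$ is a generalized metric connection (i.e. a linear connection with $\nabla G=0$) whose torsion $(0,3)$-tensor $T$ is totally skew-symmetric. Then $\nabla$ satisfies the $A$-torsion condition $$T(AX,Y)=T(X,AY)\quad\text{for all vector fields }X,Y$$ if and only if $(M,g,A,Q)$ is a weak nearly Kähler manifold. Moreover, if the $A$-torsion condition holds, then the torsion of $\nabla$ is determined by the structure tensors as follows: for all vector fields $X,Y,Z$, $$T(AX,Y,Z)=-\tfrac13\,dF(X,Y,Z),\qquad T(QX,Y,Z)=\tfrac14\,N_A(X,Y,Z)=\tfrac13\,dF(AX,Y,Z).$$
   Context: A weak almost Hermitian manifold $(M,g,A,Q)$ is a Riemannian manifold $(M,g)$ of dimension $n=2m\ge4$ with non-singular endomorphism fields $A$ (skew-symmetric with respect to $g$) and $Q$ (self-adjoint with respect to $g$) of $TM$ and a 2-form $F$ such that $A^2=-Q$, $g(AX,AY)=g(QX,Y)$, $F(X,Y)=g(AX,Y)$ for all vector fields $X,Y$. The $(0,2)$-tensor $G=g+F$ has symmetric part $g$ and skew-symmetric part $F$. It is called weak nearly Kähler if $(\nabla^g_XA)X=0$ for all $X$ (equivalently $(\nabla^g_XF)(X,Y)=0$ for all $X,Y$), where $\nabla^g$ is the Levi-Civita connection of $g$. The torsion of a linear connection $\nabla$ is $T(X,Y)=\nabla_XY-\nabla_YX-[X,Y]$, and $T(X,Y,Z):=g(T(X,Y),Z)$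 is the torsion $(0,3)$-tensor. The condition $\nabla G=0$ is equivalent to $\nabla g=\nabla F=0$, where $F(X,Y)=g(AX,Y)$. The exterior derivative is normalized without the factor $1/3$: for pairwise commuting vector fields, $dF(X,Y,Z)=X(F(Y,Z))+Y(F(Z,X))+Z(F(X,Y))$. The Nijenhuis tensor of $A$ is $N_A(X,Y)=[AX,AY]+A^2[X,Y]-A[AX,Y]-A[X,AY]$, and $N_A(X,Y,Z):=g(N_A(X,Y),Z)$. *)

theory Defs
  imports "HOL-Analysis.Analysis" "HOL-Library.Function_Algebras"
begin

text \<open>
  Sums, differences, negatives, products and zero of functions are the pointwise ones of
  \<open>HOL-Library.Function_Algebras\<close>; this covers smooth functions, tangent vectors,
  vector fields and tensor fields.
\<close>

section \<open>Smooth manifolds\<close>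

text \<open>Only meaningful on open sets \<open>S\<close>.\<close>

primrec Ck_on :: "nat \<Rightarrow> 'a::euclidean_space set \<Rightarrow> ('a \<Rightarrow> 'b::real_normed_vector) \<Rightarrow> bool" where
  "Ck_on 0 S f \<longleftrightarrow> continuous_on S f"
| "Ck_on (Suc k) S f \<longleftrightarrow> (\<forall>x\<in>S. f differentiable (at x)) \<and>
     (\<forall>v. Ck_on k S (\<lambda>x. frechet_derivative f (at x) v))"

definition smooth_on :: "'a::euclidean_space set \<Rightarrow> ('a \<Rightarrow> 'b::real_normed_vector) \<Rightarrow> bool" where
  "smooth_on S f \<longleftrightarrow> (\<forall>k. Ck_on k S f)"

record ('m, 'e) manifold =
  mtop :: "'m topology"
  atlas :: "('m set \<times> ('m \<Rightarrow> 'e)) set"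

abbreviation points :: "('m, 'e) manifold \<Rightarrow> 'm set" where
  "points M \<equiv> topspace (mtop M)"

text \<open>The atlas is not required to be maximal; the smooth structure is the one it generates.\<close>

definition smooth_manifold :: "('m, 'e::euclidean_space) manifold \<Rightarrow> bool" where
  "smooth_manifold M \<longleftrightarrow>
     Hausdorff_space (mtop M) \<and> second_countable (mtop M) \<and>
     (\<Union>(U, \<phi>)\<in>atlas M. U) = points M \<and>
     (\<forall>(U, \<phi>)\<in>atlas M. openin (mtop M) U \<and> open (\<phi> ` U) \<and>
        homeomorphic_map (subtopology (mtop M) U) (top_of_set (\<phi> ` U)) \<phi>) \<and>
     (\<forall>(U, \<phi>)\<in>atlas M. \<forall>(V, \<psi>)\<in>atlas M.
        smooth_on (\<phi> ` (U \<inter> V)) (\<psi> \<circ> inv_into U \<phi>))"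

text \<open>The values of \<open>f\<close> outside \<open>points M\<close> are unconstrained.\<close>

definition smooth_funs :: "('m, 'e::euclidean_space) manifold \<Rightarrow> ('m \<Rightarrow> real) set" where
  "smooth_funs M = {f. \<forall>(U, \<phi>)\<in>atlas M. smooth_on (\<phi> ` U) (f \<circ> inv_into U \<phi>)}"

section \<open>Tangent vectors, vector fields, tensor fields\<close>

type_synonym 'm tangent = "('m \<Rightarrow> real) \<Rightarrow> real"
type_synonym 'm vfield = "'m \<Rightarrow> 'm tangent"
type_synonym 'm endo = "'m \<Rightarrow> 'm tangent \<Rightarrow> 'm tangent"
type_synonym 'm bilin = "'m \<Rightarrow> 'm tangent \<Rightarrow> 'm tangent \<Rightarrow> real"
type_synonym 'm conn = "'m vfield \<Rightarrow> 'm vfield \<Rightarrow> 'm vfield"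

text \<open>
  Tangent vectors at \<open>p\<close> are the derivations at \<open>p\<close> of the algebra of smooth functions.
  The value 0 on non-smooth functions only makes equality of functions agree with equality
  of derivations. A derivation does not see the values of \<open>f\<close> outside \<open>points M\<close>: if \<open>f\<close>
  vanishes on \<open>points M\<close> and \<open>h\<close> is the indicator of the complement of \<open>points M\<close>, then \<open>h\<close>
  is smooth and \<open>v f = v (f * h) = f p * v h + h p * v f = 0\<close>.
\<close>

definition tangent_space :: "('m, 'e::euclidean_space) manifold \<Rightarrow> 'm \<Rightarrow> 'm tangent set" where
  "tangent_space M p = {v.
     (\<forall>f\<in>smooth_funs M. \<forall>h\<in>smooth_funs M. v (f + h) = v f + v h) \<and>
     (\<forall>c. \<forall>f\<in>smooth_funs M. v (\<lambda>x. c * f x) = c * v f) \<and>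
     (\<forall>f\<in>smooth_funs M. \<forall>h\<in>smooth_funs M. v (f * h) = f p * v h + h p * v f) \<and>
     (\<forall>f. f \<notin> smooth_funs M \<longrightarrow> v f = 0)}"

definition scale_tangent :: "real \<Rightarrow> 'm tangent \<Rightarrow> 'm tangent" where
  "scale_tangent c v = (\<lambda>f. c * v f)"

text \<open>Vector fields and endomorphism fields are set to zero outside \<open>points M\<close>.\<close>

definition vector_fields :: "('m, 'e::euclidean_space) manifold \<Rightarrow> 'm vfield set" where
  "vector_fields M = {X.
     (\<forall>p\<in>points M. X p \<in> tangent_space M p) \<and> (\<forall>p. p \<notin> points M \<longrightarrow> X p = 0) \<and>
     (\<forall>f\<in>smooth_funs M. (\<lambda>p. X p f) \<in> smooth_funs M)}"

definition deriv_along :: "'m vfield \<Rightarrow> ('m \<Rightarrow> real) \<Rightarrow> 'm \<Rightarrow> real" where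
  "deriv_along X f = (\<lambda>p. X p f)"

definition smul :: "('m \<Rightarrow> real) \<Rightarrow> 'm vfield \<Rightarrow> 'm vfield" where
  "smul f X = (\<lambda>p. scale_tangent (f p) (X p))"

definition bracket :: "'m vfield \<Rightarrow> 'm vfield \<Rightarrow> 'm vfield" where
  "bracket X Y = (\<lambda>p f. X p (deriv_along Y f) - Y p (deriv_along X f))"

definition app :: "'m endo \<Rightarrow> 'm vfield \<Rightarrow> 'm vfield" where
  "app A X = (\<lambda>p. A p (X p))"

definition pairing :: "'m bilin \<Rightarrow> 'm vfield \<Rightarrow> 'm vfield \<Rightarrow> 'm \<Rightarrow> real" where
  "pairing b X Y = (\<lambda>p. b p (X p) (Y p))"

definition linear_at ::
  "('m, 'e::euclidean_space) manifold \<Rightarrow> 'm \<Rightarrow> ('m tangent \<Rightarrow> 'm tangent) \<Rightarrow> bool" where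
  "linear_at M p L \<longleftrightarrow>
     (\<forall>v\<in>tangent_space M p. L v \<in> tangent_space M p) \<and>
     (\<forall>v\<in>tangent_space M p. \<forall>w\<in>tangent_space M p. L (v + w) = L v + L w) \<and>
     (\<forall>c. \<forall>v\<in>tangent_space M p. L (scale_tangent c v) = scale_tangent c (L v))"

definition bilinear_at ::
  "('m, 'e::euclidean_space) manifold \<Rightarrow> 'm \<Rightarrow> ('m tangent \<Rightarrow> 'm tangent \<Rightarrow> real) \<Rightarrow> bool" where
  "bilinear_at M p b \<longleftrightarrow>
     (\<forall>u\<in>tangent_space M p. \<forall>v\<in>tangent_space M p. \<forall>w\<in>tangent_space M p.
        b (u + v) w = b u w + b v w \<and> b u (v + w) = b u v + b u w) \<and>
     (\<forall>c. \<forall>v\<in>tangent_space M p. \<forall>w\<in>tangent_space M p.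
        b (scale_tangent c v) w = c * b v w \<and> b v (scale_tangent c w) = c * b v w)"

text \<open>A fibrewise linear field is smooth iff it maps smooth vector fields to smooth ones.\<close>

definition endo_field :: "('m, 'e::euclidean_space) manifold \<Rightarrow> 'm endo \<Rightarrow> bool" where
  "endo_field M A \<longleftrightarrow>
     (\<forall>p\<in>points M. linear_at M p (A p)) \<and> (\<forall>p. p \<notin> points M \<longrightarrow> A p = 0) \<and>
     (\<forall>X\<in>vector_fields M. app A X \<in> vector_fields M)"

definition nonsingular :: "('m, 'e::euclidean_space) manifold \<Rightarrow> 'm endo \<Rightarrow> bool" where
  "nonsingular M A \<longleftrightarrow>
     (\<forall>p\<in>points M. bij_betw (A p) (tangent_space M p) (tangent_space M p))"

definition riemannian_metric :: "('m, 'e::euclidean_space) manifold \<Rightarrow> 'm bilin \<Rightarrow> bool" where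
  "riemannian_metric M g \<longleftrightarrow>
     (\<forall>p\<in>points M. bilinear_at M p (g p) \<and>
        (\<forall>v\<in>tangent_space M p. \<forall>w\<in>tangent_space M p. g p v w = g p w v) \<and>
        (\<forall>v\<in>tangent_space M p. v \<noteq> 0 \<longrightarrow> g p v v > 0)) \<and>
     (\<forall>X\<in>vector_fields M. \<forall>Y\<in>vector_fields M. pairing g X Y \<in> smooth_funs M)"

section \<open>Linear connections\<close>

text \<open>
  The last clause fixes the irrelevant values of \<open>D\<close> on arguments that are not vector fields,
  so that the Levi-Civita connection is unique as a function.
\<close>

definition linear_connection :: "('m, 'e::euclidean_space) manifold \<Rightarrow> 'm conn \<Rightarrow> bool" where
  "linear_connection M D \<longleftrightarrow>
     (\<forall>X\<in>vector_fields M. \<forall>Y\<in>vector_fields M. D X Y \<in> vector_fields M) \<and>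
     (\<forall>X\<in>vector_fields M. \<forall>Y\<in>vector_fields M. \<forall>Z\<in>vector_fields M.
        D (X + Y) Z = D X Z + D Y Z \<and> D X (Y + Z) = D X Y + D X Z) \<and>
     (\<forall>f\<in>smooth_funs M. \<forall>X\<in>vector_fields M. \<forall>Y\<in>vector_fields M.
        D (smul f X) Y = smul f (D X Y) \<and>
        D X (smul f Y) = smul (deriv_along X f) Y + smul f (D X Y)) \<and>
     (\<forall>X Y. X \<notin> vector_fields M \<or> Y \<notin> vector_fields M \<longrightarrow> D X Y = 0)"

definition torsion :: "'m conn \<Rightarrow> 'm conn" where
  "torsion D X Y = D X Y - D Y X - bracket X Y"

definition torsion3 ::
  "'m bilin \<Rightarrow> 'm conn \<Rightarrow> 'm vfield \<Rightarrow> 'm vfield \<Rightarrow> 'm vfield \<Rightarrow> 'm \<Rightarrow> real" where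
  "torsion3 g D X Y Z = pairing g (torsion D X Y) Z"

definition totally_skew ::
  "('m, 'e::euclidean_space) manifold \<Rightarrow>
   ('m vfield \<Rightarrow> 'm vfield \<Rightarrow> 'm vfield \<Rightarrow> 'm \<Rightarrow> real) \<Rightarrow> bool" where
  "totally_skew M T \<longleftrightarrow>
     (\<forall>X\<in>vector_fields M. \<forall>Y\<in>vector_fields M. \<forall>Z\<in>vector_fields M. \<forall>p\<in>points M.
        T X Y Z p = - T Y X Z p \<and> T X Y Z p = - T X Z Y p)"

definition nabla_bilin ::
  "'m conn \<Rightarrow> 'm bilin \<Rightarrow> 'm vfield \<Rightarrow> 'm vfield \<Rightarrow> 'm vfield \<Rightarrow> 'm \<Rightarrow> real" where
  "nabla_bilin D b X Y Z =
     deriv_along X (pairing b Y Z) - pairing b (D X Y) Z - pairing b Y (D X Z)"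

definition nabla_endo :: "'m conn \<Rightarrow> 'm endo \<Rightarrow> 'm vfield \<Rightarrow> 'm vfield \<Rightarrow> 'm vfield" where
  "nabla_endo D A X Y = D X (app A Y) - app A (D X Y)"

definition parallel_bilin ::
  "('m, 'e::euclidean_space) manifold \<Rightarrow> 'm conn \<Rightarrow> 'm bilin \<Rightarrow> bool" where
  "parallel_bilin M D b \<longleftrightarrow>
     (\<forall>X\<in>vector_fields M. \<forall>Y\<in>vector_fields M. \<forall>Z\<in>vector_fields M. \<forall>p\<in>points M.
        nabla_bilin D b X Y Z p = 0)"

definition is_levi_civita ::
  "('m, 'e::euclidean_space) manifold \<Rightarrow> 'm bilin \<Rightarrow> 'm conn \<Rightarrow> bool" where
  "is_levi_civita M g D \<longleftrightarrow> linear_connection M D \<and> parallel_bilin M D g \<and>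
     (\<forall>X\<in>vector_fields M. \<forall>Y\<in>vector_fields M. torsion D X Y = 0)"

definition levi_civita :: "('m, 'e::euclidean_space) manifold \<Rightarrow> 'm bilin \<Rightarrow> 'm conn" where
  "levi_civita M g = (THE D. is_levi_civita M g D)"

section \<open>Weak almost Hermitian manifolds\<close>

definition fundamental_form :: "'m bilin \<Rightarrow> 'm endo \<Rightarrow> 'm bilin" where
  "fundamental_form g A = (\<lambda>p v w. g p (A p v) w)"

text \<open>That \<open>fundamental_form g A\<close> is a 2-form is the skew-symmetry of \<open>A\<close>.\<close>

definition weak_almost_hermitian ::
  "('m, 'e::euclidean_space) manifold \<Rightarrow> 'm bilin \<Rightarrow> 'm endo \<Rightarrow> 'm endo \<Rightarrow> bool" where
  "weak_almost_hermitian M g A Q \<longleftrightarrow>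
     smooth_manifold M \<and> even (DIM('e)) \<and> DIM('e) \<ge> 4 \<and>
     riemannian_metric M g \<and>
     endo_field M A \<and> nonsingular M A \<and> endo_field M Q \<and> nonsingular M Q \<and>
     (\<forall>p\<in>points M. \<forall>v\<in>tangent_space M p.
        A p (A p v) = - Q p v \<and>
        (\<forall>w\<in>tangent_space M p.
           g p (A p v) w = - g p v (A p w) \<and>
           g p (Q p v) w = g p v (Q p w) \<and>
           g p (A p v) (A p w) = g p (Q p v) w))"

definition weak_nearly_kaehler ::
  "('m, 'e::euclidean_space) manifold \<Rightarrow> 'm bilin \<Rightarrow> 'm endo \<Rightarrow> 'm endo \<Rightarrow> bool" where
  "weak_nearly_kaehler M g A Q \<longleftrightarrow> weak_almost_hermitian M g A Q \<and>
     (\<forall>X\<in>vector_fields M. nabla_endo (levi_civita M g) A X X = 0)"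

definition generalized_metric_connection ::
  "('m, 'e::euclidean_space) manifold \<Rightarrow> 'm bilin \<Rightarrow> 'm conn \<Rightarrow> bool" where
  "generalized_metric_connection M G D \<longleftrightarrow> linear_connection M D \<and> parallel_bilin M D G"

definition A_torsion_condition ::
  "('m, 'e::euclidean_space) manifold \<Rightarrow> 'm endo \<Rightarrow> 'm conn \<Rightarrow> bool" where
  "A_torsion_condition M A D \<longleftrightarrow>
     (\<forall>X\<in>vector_fields M. \<forall>Y\<in>vector_fields M. torsion D (app A X) Y = torsion D X (app A Y))"

text \<open>
  The exterior derivative of a 2-form, normalized without the factor 1/3. The bracket terms
  vanish on commuting fields and make the expression tensorial on arbitrary ones.
\<close>

definition ext_deriv ::
  "'m bilin \<Rightarrow> 'm vfield \<Rightarrow> 'm vfield \<Rightarrow> 'm vfield \<Rightarrow> 'm \<Rightarrow> real" where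
  "ext_deriv F X Y Z =
     deriv_along X (pairing F Y Z) + deriv_along Y (pairing F Z X) + deriv_along Z (pairing F X Y)
     - pairing F (bracket X Y) Z - pairing F (bracket Y Z) X - pairing F (bracket Z X) Y"

definition nijenhuis :: "'m endo \<Rightarrow> 'm vfield \<Rightarrow> 'm vfield \<Rightarrow> 'm vfield" where
  "nijenhuis A X Y =
     bracket (app A X) (app A Y) + app A (app A (bracket X Y))
     - app A (bracket (app A X) Y) - app A (bracket X (app A Y))"

definition nijenhuis3 ::
  "'m bilin \<Rightarrow> 'm endo \<Rightarrow> 'm vfield \<Rightarrow> 'm vfield \<Rightarrow> 'm vfield \<Rightarrow> 'm \<Rightarrow> real" where
  "nijenhuis3 g A X Y Z = pairing g (nijenhuis A X Y) Z"

end

theory Submission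
  imports Defs
begin

text \<open>
  Write \<open>T\<close> for the torsion of \<open>D\<close>, also with all arguments lowered by \<open>g\<close>. The symmetric and the
  skew-symmetric part of \<open>D G = 0\<close> say that \<open>D g = 0\<close> and \<open>D F = 0\<close>, and the two together give
  \<open>D A = 0\<close> (\<open>parallel_split\<close>, \<open>connection_app\<close>).

  Since \<open>T\<close> is totally skew-symmetric, \<open>D X Y - 1/2 T(X, Y)\<close> is again metric, and it is
  torsion-free, so it is the Levi-Civita connection (\<open>levi_civita_eq\<close>). Thus \<open>D\<close> itself witnesses the
  existence of the latter. Uniqueness (\<open>levi_civita_unique\<close>) is an identity between vector fields,
  and it can be tested by pairing with vector fields, because a vector field orthogonal to all of
  them is orthogonal to itself (\<open>vf_eqI\<close>).

  As \<open>D A = 0\<close>, the Levi-Civita derivative of \<open>A\<close> is purely a torsion term: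
  \<open>(\<nabla>\<^sub>X A) Y = 1/2 (A T(X, Y) - T(X, A Y))\<close>. On the diagonal \<open>T(X, X) = 0\<close>, so the manifold is weak
  nearly Kaehler iff \<open>T(X, A X) = 0\<close> for all \<open>X\<close>, and polarizing this gives
  \<open>T(A X, Y) = T(X, A Y)\<close> (\<open>A_torsion_condition_iff\<close>).

  For the formulas, the brackets in \<open>dF\<close> and \<open>N\<^sub>A\<close> are replaced by
  \<open>[X, Y] = D X Y - D Y X - T(X, Y)\<close>. The derivative terms cancel because \<open>F\<close> and \<open>A\<close> are
  parallel, and what remains are three and four values of \<open>T\<close> in which \<open>A\<close> occurs once and twice,
  respectively (\<open>ext_deriv_torsion\<close>, \<open>nijenhuis3_torsion\<close>). Under the \<open>A\<close>-torsion condition and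
  total skew-symmetry, \<open>A\<close> may be moved freely between the arguments of \<open>T\<close>, so that these values
  coincide: this is where the factors \<open>1/3\<close> and \<open>1/4\<close> come from.
\<close>

section \<open>Smooth functions form an algebra\<close>

text \<open>
  Openness of \<open>S\<close> matters here and below: derivatives are taken in the whole space, so they depend
  only on the values on \<open>S\<close> if \<open>S\<close> is a neighbourhood of each of its points.
\<close>

lemma Ck_on_cong:
  assumes "open S" "Ck_on k S f" "\<And>x. x \<in> S \<Longrightarrow> f x = h x"
  shows "Ck_on k S h"
  using assms(2,3)
proof (induction k arbitrary: f h)
  case 0
  then show ?case by (simp cong: continuous_on_cong)
next
  case (Suc k)
  have df: "f differentiable (at x)" if "x \<in> S" for x
    using Suc.prems(1) that by simp
  have "frechet_derivative f (at x) = frechet_derivative h (at x)" if "x \<in> S" for x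
    using frechet_derivative_transform_within_open[OF df[OF that] \<open>open S\<close> that] Suc.prems(2)
    by simp
  moreover have "h differentiable (at x)" if "x \<in> S" for x
    using df[OF that] has_derivative_transform_within_open[of f _ x UNIV S h, OF _ \<open>open S\<close> that]
      Suc.prems(2) unfolding differentiable_def by metis
  ultimately show ?case
    using Suc.prems(1) Suc.IH[of "\<lambda>x. frechet_derivative f (at x) v"
        "\<lambda>x. frechet_derivative h (at x) v" for v] by simp
qed

lemma Ck_on_SucD: "Ck_on (Suc k) S f \<Longrightarrow> Ck_on k S f"
proof (induction k arbitrary: f)
  case 0
  then show ?case
    by (auto intro!: continuous_at_imp_continuous_on differentiable_imp_continuous_within)
next
  case (Suc k)
  show ?case
    unfolding Ck_on.simps(2)
  proof (intro conjI allI)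
    show "\<forall>x\<in>S. f differentiable (at x)" using Suc.prems by simp
    fix v
    have "Ck_on (Suc k) S (\<lambda>x. frechet_derivative f (at x) v)"
      using Suc.prems unfolding Ck_on.simps(2)[of "Suc k"] by blast
    then show "Ck_on k S (\<lambda>x. frechet_derivative f (at x) v)"
      by (rule Suc.IH)
  qed
qed

lemma Ck_on_const: "Ck_on k S (\<lambda>_. c)"
  by (induction k arbitrary: c) auto

lemma Ck_on_add:
  assumes "open S" "Ck_on k S f" "Ck_on k S h"
  shows "Ck_on k S (\<lambda>x. f x + h x)"
  using assms(2,3)
proof (induction k arbitrary: f h)
  case 0
  then show ?case by (auto intro: continuous_on_add)
next
  case (Suc k)
  let ?d = "\<lambda>f x v. frechet_derivative f (at x) v"
  have df: "f differentiable (at x)" "h differentiable (at x)" if "x \<in> S" for x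
    using Suc.prems that by auto
  have sum: "((\<lambda>x. f x + h x) has_derivative (\<lambda>v. ?d f x v + ?d h x v)) (at x)"
    if "x \<in> S" for x
    using df[OF that] by (intro has_derivative_add) (simp_all add: frechet_derivative_works[symmetric])
  have "Ck_on k S (\<lambda>x. ?d (\<lambda>x. f x + h x) x v)" for v
  proof (rule Ck_on_cong[OF \<open>open S\<close>])
    show "Ck_on k S (\<lambda>x. ?d f x v + ?d h x v)"
      using Suc.prems by (intro Suc.IH) simp_all
    show "?d f x v + ?d h x v = ?d (\<lambda>x. f x + h x) x v" if "x \<in> S" for x
      using frechet_derivative_at[OF sum[OF that]] by metis
  qed
  then show ?case using sum by (auto simp: differentiable_def)
qed

text \<open>
  By the product rule, the derivative of the product contains the undifferentiated factors, to
  which the induction hypothesis applies because \<open>C\<^sup>k\<^sup>+\<^sup>1\<close> functions are \<open>C\<^sup>k\<close>.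
\<close>

lemma Ck_on_mult:
  fixes f h :: "'a::euclidean_space \<Rightarrow> real"
  assumes "open S" "Ck_on k S f" "Ck_on k S h"
  shows "Ck_on k S (\<lambda>x. f x * h x)"
  using assms(2,3)
proof (induction k arbitrary: f h)
  case 0
  then show ?case by (auto intro: continuous_on_mult)
next
  case (Suc k)
  let ?d = "\<lambda>f x v. frechet_derivative f (at x) v"
  have df: "f differentiable (at x)" "h differentiable (at x)" if "x \<in> S" for x
    using Suc.prems that by auto
  have prod: "((\<lambda>x. f x * h x) has_derivative (\<lambda>v. f x * ?d h x v + ?d f x v * h x)) (at x)"
    if "x \<in> S" for x
    using df[OF that] by (intro has_derivative_mult) (simp_all add: frechet_derivative_works[symmetric])
  have "Ck_on k S (\<lambda>x. ?d (\<lambda>x. f x * h x) x v)" for v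
  proof (rule Ck_on_cong[OF \<open>open S\<close>])
    show "Ck_on k S (\<lambda>x. f x * ?d h x v + ?d f x v * h x)"
      using Suc.prems Ck_on_SucD[OF Suc.prems(1)] Ck_on_SucD[OF Suc.prems(2)]
      by (intro Ck_on_add[OF \<open>open S\<close>] Suc.IH) simp_all
    show "f x * ?d h x v + ?d f x v * h x = ?d (\<lambda>x. f x * h x) x v" if "x \<in> S" for x
      using frechet_derivative_at[OF prod[OF that]] by metis
  qed
  then show ?case using prod by (auto simp: differentiable_def)
qed

locale smooth_mfd =
  fixes M :: "('m, 'e::euclidean_space) manifold"
  assumes smooth_manifold: "smooth_manifold M"
begin

abbreviation "VF \<equiv> vector_fields M"
abbreviation "TS \<equiv> tangent_space M"
abbreviation "SF \<equiv> smooth_funs M"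

lemma chart:
  assumes "(U, \<phi>) \<in> atlas M"
  shows "open (\<phi> ` U)" "U \<subseteq> points M"
  using smooth_manifold assms openin_subset unfolding smooth_manifold_def by fast+

lemma inv_chart_in_points:
  assumes "(U, \<phi>) \<in> atlas M" "y \<in> \<phi> ` U"
  shows "inv_into U \<phi> y \<in> points M"
  using chart(2)[OF assms(1)] inv_into_into[OF assms(2)] by blast

lemma smooth_funs_cong:
  assumes "f \<in> SF" "\<And>p. p \<in> points M \<Longrightarrow> f p = h p"
  shows "h \<in> SF"
proof -
  have "Ck_on k (\<phi> ` U) (h \<circ> inv_into U \<phi>)" if "(U, \<phi>) \<in> atlas M" for U \<phi> k
  proof (rule Ck_on_cong[OF chart(1)[OF that]])
    show "Ck_on k (\<phi> ` U) (f \<circ> inv_into U \<phi>)"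
      using assms(1) that by (auto simp: smooth_funs_def smooth_on_def)
  qed (use assms(2) inv_chart_in_points[OF that] in auto)
  then show ?thesis by (auto simp: smooth_funs_def smooth_on_def)
qed

lemma smooth_funs_const: "(\<lambda>_. c) \<in> SF"
  by (auto simp: smooth_funs_def smooth_on_def comp_def Ck_on_const)

lemma smooth_funs_zero: "0 \<in> SF"
  using smooth_funs_const[of 0] by (simp add: zero_fun_def)

lemma smooth_funs_add: "f \<in> SF \<Longrightarrow> h \<in> SF \<Longrightarrow> f + h \<in> SF"
  using chart by (auto simp: smooth_funs_def smooth_on_def comp_def intro!: Ck_on_add)

lemma smooth_funs_mult: "f \<in> SF \<Longrightarrow> h \<in> SF \<Longrightarrow> f * h \<in> SF"
  using chart by (auto simp: smooth_funs_def smooth_on_def comp_def intro!: Ck_on_mult)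

lemma smooth_funs_scale: "f \<in> SF \<Longrightarrow> (\<lambda>p. c * f p) \<in> SF"
  using smooth_funs_mult[OF smooth_funs_const[of c], of f] by (simp add: times_fun_def)

lemma smooth_funs_uminus: "f \<in> SF \<Longrightarrow> - f \<in> SF"
  using smooth_funs_scale[of f "-1"] by (simp add: fun_Compl_def)

lemma smooth_funs_diff: "f \<in> SF \<Longrightarrow> h \<in> SF \<Longrightarrow> f - h \<in> SF"
  using smooth_funs_add[OF _ smooth_funs_uminus[of h]] by fastforce

section \<open>Vector fields form a module closed under the bracket\<close>

lemma tangent_zero: "0 \<in> TS p"
  by (simp add: tangent_space_def)

lemma tangent_add: "v \<in> TS p \<Longrightarrow> w \<in> TS p \<Longrightarrow> v + w \<in> TS p"
  by (auto simp: tangent_space_def algebra_simps)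

lemma tangent_scale: "v \<in> TS p \<Longrightarrow> scale_tangent c v \<in> TS p"
  by (auto simp: tangent_space_def scale_tangent_def algebra_simps)

lemma uminus_eq_scale: "- v = scale_tangent (-1) v"
  by (simp add: scale_tangent_def fun_eq_iff)

lemma derivation_add: "v \<in> TS p \<Longrightarrow> f \<in> SF \<Longrightarrow> h \<in> SF \<Longrightarrow> v (f + h) = v f + v h"
  by (simp add: tangent_space_def)

lemma derivation_scale: "v \<in> TS p \<Longrightarrow> f \<in> SF \<Longrightarrow> v (\<lambda>x. c * f x) = c * v f"
  by (simp add: tangent_space_def)

lemma derivation_mult: "v \<in> TS p \<Longrightarrow> f \<in> SF \<Longrightarrow> h \<in> SF \<Longrightarrow> v (f * h) = f p * v h + h p * v f"
  by (simp add: tangent_space_def)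

lemma derivation_nonsmooth: "v \<in> TS p \<Longrightarrow> f \<notin> SF \<Longrightarrow> v f = 0"
  by (simp add: tangent_space_def)

lemma derivation_zero: "v \<in> TS p \<Longrightarrow> v 0 = 0"
  using derivation_scale[of v p 0 0] smooth_funs_zero by (simp add: zero_fun_def)

lemma derivation_uminus: "v \<in> TS p \<Longrightarrow> f \<in> SF \<Longrightarrow> v (- f) = - v f"
  using derivation_scale[of v p f "-1"] by (simp add: fun_Compl_def)

lemma derivation_diff: "v \<in> TS p \<Longrightarrow> f \<in> SF \<Longrightarrow> h \<in> SF \<Longrightarrow> v (f - h) = v f - v h"
  using derivation_add[of v p f "- h"] by (simp add: derivation_uminus smooth_funs_uminus)

text \<open>
  The metric is unconstrained outside \<open>points M\<close>, so the symmetry of \<open>g\<close> makes \<open>pairing g X Y\<close> and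
  \<open>pairing g Y X\<close> agree on \<open>points M\<close> only. This lemma makes their derivatives agree nevertheless:
  the difference of two such functions is unchanged by multiplication with the indicator of the
  complement of \<open>points M\<close>, and both factors vanish at \<open>p\<close>.
\<close>

lemma derivation_cong:
  assumes v: "v \<in> TS p" and p: "p \<in> points M" and smooth: "f \<in> SF" "h \<in> SF"
    and eq: "\<And>q. q \<in> points M \<Longrightarrow> f q = h q"
  shows "v f = v h"
proof -
  define e :: "'m \<Rightarrow> real" where "e = (\<lambda>q. if q \<in> points M then 0 else 1)"
  have e: "e \<in> SF"
    by (rule smooth_funs_cong[OF smooth_funs_zero]) (simp add: e_def)
  have "f - h = (f - h) * e"
    using eq by (auto simp: fun_eq_iff e_def)
  then have "v (f - h) = v ((f - h) * e)"
    by simp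
  also have "\<dots> = (f - h) p * v e + e p * v (f - h)"
    using derivation_mult[OF v smooth_funs_diff[OF smooth] e] .
  also have "\<dots> = 0"
    using eq[OF p] p by (simp add: e_def)
  finally show ?thesis
    using derivation_diff[OF v smooth] by simp
qed

lemma vf_tangent: "X \<in> VF \<Longrightarrow> X p \<in> TS p"
  using tangent_zero by (cases "p \<in> points M") (auto simp: vector_fields_def)

lemma vf_off: "X \<in> VF \<Longrightarrow> p \<notin> points M \<Longrightarrow> X p = 0"
  by (simp add: vector_fields_def)

lemma vf_smooth: "X \<in> VF \<Longrightarrow> f \<in> SF \<Longrightarrow> deriv_along X f \<in> SF"
  by (simp add: vector_fields_def deriv_along_def)

lemma vfI:
  assumes "\<And>p. p \<in> points M \<Longrightarrow> X p \<in> TS p" "\<And>p. p \<notin> points M \<Longrightarrow> X p = 0"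
    "\<And>f. f \<in> SF \<Longrightarrow> deriv_along X f \<in> SF"
  shows "X \<in> VF"
  using assms by (auto simp: vector_fields_def deriv_along_def)

lemma vf_add:
  assumes "X \<in> VF" "Y \<in> VF"
  shows "X + Y \<in> VF"
proof (rule vfI)
  fix f assume "f \<in> SF"
  then have "deriv_along X f + deriv_along Y f \<in> SF"
    using assms by (intro smooth_funs_add vf_smooth)
  then show "deriv_along (X + Y) f \<in> SF"
    by (simp add: deriv_along_def plus_fun_def)
next
  fix p show "(X + Y) p \<in> TS p"
    using tangent_add[OF vf_tangent vf_tangent] assms by simp
qed (use assms in \<open>simp add: vf_off fun_eq_iff\<close>)

lemma deriv_along_smul: "deriv_along (smul f X) h = f * deriv_along X h"
  by (simp add: deriv_along_def smul_def scale_tangent_def fun_eq_iff)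

lemma vf_smul:
  assumes "f \<in> SF" "X \<in> VF"
  shows "smul f X \<in> VF"
proof (rule vfI)
  fix h assume "h \<in> SF"
  then show "deriv_along (smul f X) h \<in> SF"
    using assms by (simp add: deriv_along_smul smooth_funs_mult vf_smooth)
next
  fix p show "smul f X p \<in> TS p"
    unfolding smul_def using tangent_scale[OF vf_tangent] assms by simp
qed (use assms in \<open>simp add: vf_off smul_def scale_tangent_def fun_eq_iff\<close>)

lemma vf_uminus: "X \<in> VF \<Longrightarrow> - X \<in> VF"
  using vf_smul[OF smooth_funs_const[of "-1"], of X]
  by (simp add: smul_def fun_Compl_def uminus_eq_scale[symmetric])

lemma vf_diff: "X \<in> VF \<Longrightarrow> Y \<in> VF \<Longrightarrow> X - Y \<in> VF"
  using vf_add[OF _ vf_uminus[of Y]] by fastforce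

lemma deriv_along_add:
  "X \<in> VF \<Longrightarrow> f \<in> SF \<Longrightarrow> h \<in> SF \<Longrightarrow> deriv_along X (f + h) = deriv_along X f + deriv_along X h"
  by (simp add: deriv_along_def fun_eq_iff derivation_add[OF vf_tangent])

lemma deriv_along_scale:
  "X \<in> VF \<Longrightarrow> f \<in> SF \<Longrightarrow> deriv_along X (\<lambda>p. c * f p) = (\<lambda>p. c * deriv_along X f p)"
  by (simp add: deriv_along_def fun_eq_iff derivation_scale[OF vf_tangent])

lemma deriv_along_mult:
  "X \<in> VF \<Longrightarrow> f \<in> SF \<Longrightarrow> h \<in> SF \<Longrightarrow>
    deriv_along X (f * h) = f * deriv_along X h + h * deriv_along X f"
  by (simp add: deriv_along_def fun_eq_iff derivation_mult[OF vf_tangent])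

lemma deriv_along_nonsmooth: "X \<in> VF \<Longrightarrow> f \<notin> SF \<Longrightarrow> deriv_along X f = 0"
  by (simp add: deriv_along_def fun_eq_iff derivation_nonsmooth[OF vf_tangent])

lemma deriv_along_cong:
  "X \<in> VF \<Longrightarrow> f \<in> SF \<Longrightarrow> h \<in> SF \<Longrightarrow> (\<And>q. q \<in> points M \<Longrightarrow> f q = h q) \<Longrightarrow> p \<in> points M \<Longrightarrow>
    deriv_along X f p = deriv_along X h p"
  unfolding deriv_along_def by (rule derivation_cong[OF vf_tangent])

text \<open>
  In the product rule for \<open>XY - YX\<close> the mixed terms \<open>(X f) (Y h)\<close> cancel. On a non-smooth function
  the bracket is 0, as required of a tangent vector, because the inner derivative is the zero
  function.
\<close>

lemma bracket_vf:
  assumes X: "X \<in> VF" and Y: "Y \<in> VF"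
  shows "bracket X Y \<in> VF"
proof (rule vfI)
  fix p
  note rules = deriv_along_add deriv_along_scale deriv_along_mult vf_smooth X Y
    derivation_add[OF vf_tangent[of _ p]] derivation_scale[OF vf_tangent[of _ p]]
    derivation_mult[OF vf_tangent[of _ p]] smooth_funs_mult
  show "bracket X Y p \<in> TS p"
    unfolding tangent_space_def mem_Collect_eq bracket_def
  proof (intro conjI ballI allI impI)
    fix f h assume "f \<in> SF" "h \<in> SF"
    then show "X p (deriv_along Y (f * h)) - Y p (deriv_along X (f * h)) =
      f p * (X p (deriv_along Y h) - Y p (deriv_along X h)) +
      h p * (X p (deriv_along Y f) - Y p (deriv_along X f))"
      by (simp add: rules) (simp add: deriv_along_def algebra_simps)
  next
    fix f assume "f \<notin> SF"
    then show "X p (deriv_along Y f) - Y p (deriv_along X f) = 0"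
      using X Y by (simp add: deriv_along_nonsmooth derivation_zero[OF vf_tangent])
  qed (simp_all add: rules algebra_simps)
next
  fix f assume "f \<in> SF"
  then have "deriv_along X (deriv_along Y f) - deriv_along Y (deriv_along X f) \<in> SF"
    using X Y by (intro smooth_funs_diff vf_smooth)
  then show "deriv_along (bracket X Y) f \<in> SF"
    by (simp add: deriv_along_def bracket_def fun_diff_def)
qed (use X Y in \<open>simp add: bracket_def vf_off fun_eq_iff\<close>)

lemma bracket_add_left:
  assumes "X \<in> VF" "Y \<in> VF" "Z \<in> VF"
  shows "bracket (X + Y) Z = bracket X Z + bracket Y Z"
proof (intro ext)
  fix p f
  have *: "deriv_along (X + Y) f = deriv_along X f + deriv_along Y f"
    by (simp add: deriv_along_def fun_eq_iff)
  show "bracket (X + Y) Z p f = (bracket X Z + bracket Y Z) p f"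
  proof (cases "f \<in> SF")
    case True
    then show ?thesis
      using assms by (simp add: bracket_def * derivation_add[OF vf_tangent] vf_smooth)
  next
    case False
    then show ?thesis
      using assms by (simp add: bracket_def * deriv_along_nonsmooth derivation_zero[OF vf_tangent])
  qed
qed

lemma bracket_smul_left:
  assumes f: "f \<in> SF" and X: "X \<in> VF" and Y: "Y \<in> VF"
  shows "bracket (smul f X) Y = smul f (bracket X Y) - smul (deriv_along Y f) X"
proof (intro ext)
  fix p h
  show "bracket (smul f X) Y p h = (smul f (bracket X Y) - smul (deriv_along Y f) X) p h"
  proof (cases "h \<in> SF")
    case True
    then have "Y p (f * deriv_along X h) = f p * Y p (deriv_along X h) + X p h * Y p f"
      using assms derivation_mult[OF vf_tangent[OF Y] f vf_smooth[OF X True]]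
      by (simp add: deriv_along_def)
    then show ?thesis
      using assms by (simp add: bracket_def deriv_along_smul) (simp add: smul_def scale_tangent_def
          deriv_along_def algebra_simps)
  next
    case False
    then have "deriv_along X h = 0" "deriv_along Y h = 0" "X p h = 0" "f * (0 :: 'm \<Rightarrow> real) = 0"
      using assms by (auto simp: deriv_along_nonsmooth derivation_nonsmooth[OF vf_tangent])
    then show ?thesis
      using assms by (simp add: bracket_def deriv_along_smul derivation_zero[OF vf_tangent])
        (simp add: smul_def scale_tangent_def bracket_def derivation_zero[OF vf_tangent])
  qed
qed

end

section \<open>Metric connections with totally skew-symmetric torsion\<close>

locale riemannian = smooth_mfd M for M :: "('m, 'e::euclidean_space) manifold" +
  fixes g :: "'m bilin"
  assumes metric: "riemannian_metric M g"
begin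

lemma pairing_smooth: "X \<in> VF \<Longrightarrow> Y \<in> VF \<Longrightarrow> pairing g X Y \<in> SF"
  using metric by (simp add: riemannian_metric_def)

context
  fixes p assumes p: "p \<in> points M"
begin

lemma pairing_add:
  assumes "X \<in> VF" "Y \<in> VF" "Z \<in> VF"
  shows "pairing g (X + Y) Z p = pairing g X Z p + pairing g Y Z p"
    and "pairing g Z (X + Y) p = pairing g Z X p + pairing g Z Y p"
  using metric p assms vf_tangent
  by (auto simp: riemannian_metric_def bilinear_at_def pairing_def)

lemma pairing_smul:
  assumes "X \<in> VF" "Y \<in> VF"
  shows "pairing g (smul f X) Y p = f p * pairing g X Y p"
    and "pairing g X (smul f Y) p = f p * pairing g X Y p"
  using metric p assms vf_tangent
  by (auto simp: riemannian_metric_def bilinear_at_def pairing_def smul_def)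

lemma pairing_uminus:
  assumes "X \<in> VF" "Y \<in> VF"
  shows "pairing g (- X) Y p = - pairing g X Y p"
    and "pairing g X (- Y) p = - pairing g X Y p"
  using pairing_smul[OF assms, of "\<lambda>_. -1"]
  by (simp_all add: smul_def pairing_def uminus_eq_scale)

lemma pairing_diff:
  assumes "X \<in> VF" "Y \<in> VF" "Z \<in> VF"
  shows "pairing g (X - Y) Z p = pairing g X Z p - pairing g Y Z p"
    and "pairing g Z (X - Y) p = pairing g Z X p - pairing g Z Y p"
  using pairing_add[of X "- Y" Z] assms by (simp_all add: vf_uminus pairing_uminus)

lemma pairing_sym: "X \<in> VF \<Longrightarrow> Y \<in> VF \<Longrightarrow> pairing g X Y p = pairing g Y X p"
  using metric p vf_tangent by (simp add: riemannian_metric_def pairing_def)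

end

text \<open>The pairing with \<open>Z = X - Y\<close> already forces \<open>X = Y\<close>, by positive definiteness.\<close>

lemma vf_eqI:
  assumes X: "X \<in> VF" and Y: "Y \<in> VF"
    and eq: "\<And>Z p. Z \<in> VF \<Longrightarrow> p \<in> points M \<Longrightarrow> pairing g X Z p = pairing g Y Z p"
  shows "X = Y"
proof
  fix p
  show "X p = Y p"
  proof (cases "p \<in> points M")
    case True
    have "g p ((X - Y) p) ((X - Y) p) = 0"
      using eq[OF vf_diff[OF X Y] True] pairing_diff(1)[OF True X Y vf_diff[OF X Y]]
      by (simp add: pairing_def)
    moreover have "v \<noteq> 0 \<Longrightarrow> g p v v > 0" if "v \<in> TS p" for v
      using metric True that by (simp add: riemannian_metric_def)
    ultimately have "(X - Y) p = 0"
      using vf_tangent[OF vf_diff[OF X Y], of p] by fastforce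
    then show ?thesis by simp
  qed (use X Y vf_off in simp)
qed

text \<open>
  The difference \<open>S\<close> of two such connections is symmetric, because both are torsion-free, and
  \<open>g (S X Y) Z\<close> is skew-symmetric in \<open>Y\<close> and \<open>Z\<close>, because both are metric. A trilinear form that is
  symmetric in the first pair and skew-symmetric in the last pair of arguments vanishes.
\<close>

lemma levi_civita_unique:
  assumes "is_levi_civita M g D1" "is_levi_civita M g D2"
  shows "D1 = D2"
proof (intro ext)
  have D_vf: "D1 X Y \<in> VF" "D2 X Y \<in> VF" if "X \<in> VF" "Y \<in> VF" for X Y
    using that assms by (auto simp: is_levi_civita_def linear_connection_def)
  have metric: "nabla_bilin D1 g X Y Z p = 0" "nabla_bilin D2 g X Y Z p = 0"
    if "X \<in> VF" "Y \<in> VF" "Z \<in> VF" "p \<in> points M" for X Y Z p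
    using that assms by (auto simp: is_levi_civita_def parallel_bilin_def)
  define S where "S X Y = D1 X Y - D2 X Y" for X Y
  have S_vf: "S X Y \<in> VF" if "X \<in> VF" "Y \<in> VF" for X Y
    using that by (simp add: S_def vf_diff D_vf)
  have sym: "S X Y = S Y X" if "X \<in> VF" "Y \<in> VF" for X Y
  proof -
    have "D1 X Y - D1 Y X = bracket X Y" "D2 X Y - D2 Y X = bracket X Y"
      using that assms by (auto simp: is_levi_civita_def torsion_def)
    then have "D1 X Y - D1 Y X = D2 X Y - D2 Y X" by simp
    then show ?thesis unfolding S_def by (metis diff_add_cancel add_diff_cancel_left)
  qed
  have skew: "pairing g (S X Y) Z p = - pairing g (S X Z) Y p"
    if "X \<in> VF" "Y \<in> VF" "Z \<in> VF" "p \<in> points M" for X Y Z p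
    using metric[OF that] that
    by (simp add: S_def nabla_bilin_def pairing_diff D_vf pairing_sym[of p Y])
  have "S X Y = 0" if XY: "X \<in> VF" "Y \<in> VF" for X Y
  proof (rule vf_eqI)
    show "0 \<in> VF" using vf_diff[OF XY(1,1)] by simp
    fix Z p assume Zp: "Z \<in> VF" "p \<in> points M"
    \<comment> \<open>The symmetry and the skewness, applied alternately three times each, permute the
      arguments back to their original order with the sign \<open>-1\<close>.\<close>
    have "pairing g (S X Y) Z p = - pairing g (S X Y) Z p"
      using skew[of X Y Z p] skew[of Z X Y p] skew[of Y Z X p] XY Zp
        sym[of X Y] sym[of X Z] sym[of Y Z] by simp
    then show "pairing g (S X Y) Z p = pairing g 0 Z p"
      using pairing_diff(1)[of p X X Z] XY Zp by simp
  qed (use S_vf XY in auto)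
  then have "D1 X Y = D2 X Y" if "X \<in> VF" "Y \<in> VF" for X Y
    using that by (simp add: S_def)
  moreover have "D1 X Y = D2 X Y" if "X \<notin> VF \<or> Y \<notin> VF" for X Y
    using that assms by (auto simp: is_levi_civita_def linear_connection_def)
  ultimately show "D1 X Y p f = D2 X Y p f" for X Y p f by metis
qed

end

locale skew_torsion = riemannian M g for M :: "('m, 'e::euclidean_space) manifold" and g +
  fixes D :: "'m conn"
  assumes connection: "linear_connection M D"
    and parallel: "parallel_bilin M D g"
    and skew: "totally_skew M (torsion3 g D)"
begin

lemma connection_vf: "X \<in> VF \<Longrightarrow> Y \<in> VF \<Longrightarrow> D X Y \<in> VF"
  using connection by (simp add: linear_connection_def)

lemma connection_add:
  assumes "X \<in> VF" "Y \<in> VF" "Z \<in> VF"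
  shows "D (X + Y) Z = D X Z + D Y Z" and "D X (Y + Z) = D X Y + D X Z"
  using connection assms by (simp_all add: linear_connection_def)

lemma connection_smul:
  assumes "f \<in> SF" "X \<in> VF" "Y \<in> VF"
  shows "D (smul f X) Y = smul f (D X Y)"
    and "D X (smul f Y) = smul (deriv_along X f) Y + smul f (D X Y)"
  using connection assms by (simp_all add: linear_connection_def)

lemma torsion_vf: "X \<in> VF \<Longrightarrow> Y \<in> VF \<Longrightarrow> torsion D X Y \<in> VF"
  by (simp add: torsion_def vf_diff connection_vf bracket_vf)

lemma torsion_skew: "torsion D Y X = - torsion D X Y"
  by (simp add: torsion_def bracket_def fun_eq_iff)

lemma torsion_self: "torsion D X X = 0"
  by (simp add: torsion_def bracket_def fun_eq_iff)

lemma torsion_add_left: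
  assumes "X \<in> VF" "Y \<in> VF" "Z \<in> VF"
  shows "torsion D (X + Y) Z = torsion D X Z + torsion D Y Z"
  using assms by (simp add: torsion_def connection_add bracket_add_left)

lemma torsion_add_right:
  assumes "X \<in> VF" "Y \<in> VF" "Z \<in> VF"
  shows "torsion D Z (X + Y) = torsion D Z X + torsion D Z Y"
  unfolding torsion_skew[where Y = Z] torsion_add_left[OF assms] by simp

lemma smul_distribs:
  "smul f (X + Y) = smul f X + smul f Y" "smul f (X - Y) = smul f X - smul f Y"
  "smul f (- X) = - smul f X" "smul f (smul h X) = smul h (smul f X)"
  by (simp_all add: smul_def scale_tangent_def fun_eq_iff algebra_simps)

lemma torsion_smul_left:
  assumes "f \<in> SF" "X \<in> VF" "Y \<in> VF"
  shows "torsion D (smul f X) Y = smul f (torsion D X Y)"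
  using assms by (simp add: torsion_def connection_smul bracket_smul_left smul_distribs)

lemma torsion_smul_right:
  assumes "f \<in> SF" "X \<in> VF" "Y \<in> VF"
  shows "torsion D Y (smul f X) = smul f (torsion D Y X)"
  unfolding torsion_skew[where Y = Y] torsion_smul_left[OF assms] by (simp only: smul_distribs)

lemma torsion3_skew:
  assumes "X \<in> VF" "Y \<in> VF" "Z \<in> VF" "p \<in> points M"
  shows "torsion3 g D X Y Z p = - torsion3 g D Y X Z p"
    and "torsion3 g D X Y Z p = - torsion3 g D X Z Y p"
  using skew assms unfolding totally_skew_def by blast+

lemma torsion3_cyclic:
  assumes "X \<in> VF" "Y \<in> VF" "Z \<in> VF" "p \<in> points M"
  shows "torsion3 g D X Y Z p = torsion3 g D Y Z X p"
  using torsion3_skew(1)[OF assms] torsion3_skew(2)[OF assms(2,1,3,4)] by simp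

text \<open>
  Subtracting half of the torsion makes the connection torsion-free, and it stays metric because
  \<open>g (T X Y) Z\<close> is skew-symmetric in \<open>Y\<close> and \<open>Z\<close>. It is a connection since \<open>T\<close> is tensorial.
\<close>

lemma levi_civita_eq:
  assumes X: "X \<in> VF" and Y: "Y \<in> VF"
  shows "levi_civita M g X Y = D X Y - smul (\<lambda>_. 1 / 2) (torsion D X Y)"
proof -
  let ?h = "smul (\<lambda>_. 1 / 2 :: real) :: 'm vfield \<Rightarrow> 'm vfield"
  \<comment> \<open>The value 0 on arguments that are not vector fields is part of being a linear connection, and
    uniqueness depends on it.\<close>
  define L where
    "L X Y = (if X \<in> VF \<and> Y \<in> VF then D X Y - ?h (torsion D X Y) else 0)" for X Y
  have half: "?h X \<in> VF" if "X \<in> VF" for X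
    using that by (simp add: vf_smul smooth_funs_const)
  have "linear_connection M L"
    unfolding linear_connection_def
  proof (intro conjI ballI allI impI)
    fix X Y Z assume XYZ: "X \<in> VF" "Y \<in> VF" "Z \<in> VF"
    then show "L X Y \<in> VF"
      by (simp add: L_def vf_diff half connection_vf torsion_vf)
    show "L (X + Y) Z = L X Z + L Y Z" "L X (Y + Z) = L X Y + L X Z"
      using XYZ by (simp_all add: L_def vf_add connection_add torsion_add_left torsion_add_right
          smul_distribs(1))
  next
    fix X Y f assume "X \<in> VF" "Y \<in> VF" "f \<in> SF"
    then show "L (smul f X) Y = smul f (L X Y)"
      "L X (smul f Y) = smul (deriv_along X f) Y + smul f (L X Y)"
      by (simp_all add: L_def vf_smul connection_smul torsion_smul_left torsion_smul_right
          smul_distribs(2) smul_distribs(4)[of f "\<lambda>_. 1 / 2"])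
  qed (auto simp: L_def)
  moreover have "parallel_bilin M L g"
    unfolding parallel_bilin_def
  proof (intro ballI)
    fix X Y Z p assume XYZ: "X \<in> VF" "Y \<in> VF" "Z \<in> VF" and p: "p \<in> points M"
    have "nabla_bilin D g X Y Z p = 0"
      using parallel XYZ p by (simp add: parallel_bilin_def)
    moreover have "pairing g (torsion D X Y) Z p = - pairing g Y (torsion D X Z) p"
      using torsion3_skew(2)[OF XYZ p] XYZ
      by (simp add: torsion3_def torsion_vf pairing_sym[OF p, of Y])
    ultimately show "nabla_bilin L g X Y Z p = 0"
      using XYZ p
      by (simp add: nabla_bilin_def L_def pairing_diff pairing_smul connection_vf torsion_vf half)
  qed
  moreover have "torsion L X Y = 0" if "X \<in> VF" "Y \<in> VF" for X Y
    unfolding torsion_def L_def using that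
    by (simp add: torsion_def smul_def scale_tangent_def fun_eq_iff bracket_def) (simp add: field_simps)
  ultimately have "is_levi_civita M g L"
    by (simp add: is_levi_civita_def)
  then have "levi_civita M g = L"
    unfolding levi_civita_def using levi_civita_unique by blast
  then show ?thesis
    using X Y by (simp add: L_def)
qed

end

section \<open>Parallel skew-symmetric endomorphism fields\<close>

locale riemannian_skew_endo = riemannian M g
  for M :: "('m, 'e::euclidean_space) manifold" and g +
  fixes A :: "'m endo"
  assumes endo: "endo_field M A"
    and A_skew: "\<And>p v w. p \<in> points M \<Longrightarrow> v \<in> TS p \<Longrightarrow> w \<in> TS p \<Longrightarrow> g p (A p v) w = - g p v (A p w)"
begin

abbreviation "\<omega> \<equiv> fundamental_form g A"

lemma app_vf: "X \<in> VF \<Longrightarrow> app A X \<in> VF"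
  using endo by (simp add: endo_field_def)

lemma pairing_form: "pairing \<omega> X Y = pairing g (app A X) Y"
  by (simp add: pairing_def fundamental_form_def app_def)

lemma pairing_app_skew:
  assumes "p \<in> points M" "X \<in> VF" "Y \<in> VF"
  shows "pairing g (app A X) Y p = - pairing g X (app A Y) p"
  using A_skew[OF assms(1)] assms(2,3) by (simp add: pairing_def app_def vf_tangent)

lemma pairing_form_skew:
  assumes "p \<in> points M" "X \<in> VF" "Y \<in> VF"
  shows "pairing \<omega> X Y p = - pairing \<omega> Y X p"
  using assms by (simp add: pairing_form pairing_app_skew[of p Y] pairing_sym[of p Y] app_vf)

lemma app_add:
  assumes "X \<in> VF" "Y \<in> VF"
  shows "app A (X + Y) = app A X + app A Y"
proof
  fix p show "app A (X + Y) p = (app A X + app A Y) p"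
    using endo assms vf_tangent
    by (cases "p \<in> points M") (auto simp: app_def endo_field_def linear_at_def)
qed

lemma app_scale:
  assumes "X \<in> VF"
  shows "app A (smul (\<lambda>_. c) X) = smul (\<lambda>_. c) (app A X)"
proof
  fix p show "app A (smul (\<lambda>_. c) X) p = smul (\<lambda>_. c) (app A X) p"
    using endo assms vf_tangent
    by (cases "p \<in> points M")
      (auto simp: app_def smul_def endo_field_def linear_at_def scale_tangent_def fun_eq_iff)
qed

lemma app_diff:
  assumes "X \<in> VF" "Y \<in> VF"
  shows "app A (X - Y) = app A X - app A Y"
  using app_add[OF vf_diff[OF assms] assms(2)] by (simp add: algebra_simps)

lemma app_zero: "app A 0 = 0"
proof
  fix p
  have "(0 :: 'm tangent) = scale_tangent 0 0"
    by (simp add: scale_tangent_def fun_eq_iff)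
  moreover have "scale_tangent 0 v = 0" for v :: "'m tangent"
    by (simp add: scale_tangent_def fun_eq_iff)
  ultimately show "app A 0 p = 0 p"
    using endo tangent_zero
    by (cases "p \<in> points M") (auto simp: app_def endo_field_def linear_at_def, metis)
qed

text \<open>
  Exchanging \<open>Y\<close> and \<open>Z\<close> in \<open>(D\<^sub>X G)(Y, Z)\<close> preserves the contribution of \<open>g\<close> and reverses the sign
  of that of \<open>\<omega>\<close>; adding and subtracting the two equations separates them.
\<close>

lemma parallel_split:
  assumes D: "linear_connection M D" and par: "parallel_bilin M D (g + \<omega>)"
  shows "parallel_bilin M D g" and "parallel_bilin M D \<omega>"
proof -
  have "nabla_bilin D g X Y Z p = 0 \<and> nabla_bilin D \<omega> X Y Z p = 0"
    if XYZ: "X \<in> VF" "Y \<in> VF" "Z \<in> VF" and p: "p \<in> points M" for X Y Z p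
  proof -
    have D_vf: "D X Y \<in> VF" if "X \<in> VF" "Y \<in> VF" for X Y
      using D that by (simp add: linear_connection_def)
    have sum: "nabla_bilin D (g + \<omega>) X Y Z p = nabla_bilin D g X Y Z p + nabla_bilin D \<omega> X Y Z p"
      if "Y \<in> VF" "Z \<in> VF" for Y Z
    proof -
      have "pairing (g + \<omega>) Y Z = pairing g Y Z + pairing \<omega> Y Z" for Y Z
        by (simp add: pairing_def fun_eq_iff)
      then show ?thesis
        using XYZ(1) that by (simp add: nabla_bilin_def deriv_along_add pairing_smooth
            pairing_form app_vf)
    qed
    have "deriv_along X (pairing g Z Y) p = deriv_along X (pairing g Y Z) p"
      using XYZ p by (intro deriv_along_cong) (auto simp: pairing_smooth pairing_sym)
    then have sym: "nabla_bilin D g X Z Y p = nabla_bilin D g X Y Z p"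
      using XYZ p by (simp add: nabla_bilin_def D_vf pairing_sym[of p Z] pairing_sym[of p _ Y])
    have smooth: "pairing \<omega> Y Z \<in> SF" "pairing \<omega> Z Y \<in> SF"
      using XYZ by (simp_all add: pairing_form pairing_smooth app_vf)
    have "deriv_along X (pairing \<omega> Z Y) p = deriv_along X (\<lambda>q. - 1 * pairing \<omega> Y Z q) p"
    proof (rule deriv_along_cong[OF XYZ(1) smooth(2) smooth_funs_scale[OF smooth(1)] _ p])
      show "pairing \<omega> Z Y q = - 1 * pairing \<omega> Y Z q" if "q \<in> points M" for q
        using pairing_form_skew[OF that XYZ(3,2)] by simp
    qed
    also have "\<dots> = - deriv_along X (pairing \<omega> Y Z) p"
      using deriv_along_scale[OF XYZ(1) smooth(1), of "- 1"] by simp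
    finally have "nabla_bilin D \<omega> X Z Y p = - nabla_bilin D \<omega> X Y Z p"
      using pairing_form_skew[OF p D_vf[OF XYZ(1,2)] XYZ(3)]
        pairing_form_skew[OF p D_vf[OF XYZ(1,3)] XYZ(2)]
      by (simp add: nabla_bilin_def)
    moreover have "nabla_bilin D (g + \<omega>) X Y Z p = 0" "nabla_bilin D (g + \<omega>) X Z Y p = 0"
      using par XYZ p by (simp_all add: parallel_bilin_def)
    ultimately show ?thesis
      using sum[OF XYZ(2,3)] sum[OF XYZ(3,2)] sym by simp
  qed
  then show "parallel_bilin M D g" "parallel_bilin M D \<omega>"
    by (simp_all add: parallel_bilin_def)
qed

end

section \<open>Totally skew-symmetric torsion and the nearly Kaehler condition\<close>

locale skew_torsion_parallel_endo =
  riemannian_skew_endo M g A + skew_torsion M g D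
  for M :: "('m, 'e::euclidean_space) manifold" and g A D +
  assumes parallel_form: "parallel_bilin M D \<omega>"
begin

text \<open>
  Both \<open>D g = 0\<close>, applied to \<open>A Y\<close> and \<open>Z\<close>, and \<open>D \<omega> = 0\<close>, applied to \<open>Y\<close> and \<open>Z\<close>, compute the
  derivative of the function \<open>g (A Y) Z\<close>; comparing the results shows that \<open>A\<close> is parallel.
\<close>

lemma connection_app:
  assumes "X \<in> VF" "Y \<in> VF"
  shows "D X (app A Y) = app A (D X Y)"
proof (rule vf_eqI)
  fix Z p assume Zp: "Z \<in> VF" "p \<in> points M"
  have "nabla_bilin D \<omega> X Y Z p = 0" "nabla_bilin D g X (app A Y) Z p = 0"
    using parallel parallel_form assms Zp by (simp_all add: parallel_bilin_def app_vf)
  then show "pairing g (D X (app A Y)) Z p = pairing g (app A (D X Y)) Z p"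
    by (simp add: nabla_bilin_def pairing_form)
qed (use assms in \<open>simp_all add: connection_vf app_vf\<close>)

lemma nabla_endo_levi_civita:
  assumes "X \<in> VF" "Y \<in> VF"
  shows "nabla_endo (levi_civita M g) A X Y =
    smul (\<lambda>_. 1 / 2) (app A (torsion D X Y) - torsion D X (app A Y))"
  using assms
  by (simp add: nabla_endo_def levi_civita_eq app_vf connection_app app_diff app_scale
      connection_vf torsion_vf vf_smul smooth_funs_const smul_distribs)

text \<open>
  The right-hand side is the nearly Kaehler condition. Both sides are equivalent to
  \<open>torsion D X (app A X) = 0\<close>: the left one implies it by skew-symmetry of the torsion and follows
  from it by polarization.
\<close>

lemma A_torsion_condition_iff:
  "A_torsion_condition M A D \<longleftrightarrow> (\<forall>X\<in>VF. nabla_endo (levi_civita M g) A X X = 0)"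
proof -
  have diagonal: "nabla_endo (levi_civita M g) A X X = 0 \<longleftrightarrow> torsion D X (app A X) = 0"
    if "X \<in> VF" for X
    unfolding nabla_endo_levi_civita[OF that that] torsion_self app_zero
    by (simp add: smul_def scale_tangent_def fun_eq_iff)
  have "A_torsion_condition M A D \<longleftrightarrow> (\<forall>X\<in>VF. torsion D X (app A X) = 0)"
  proof
    assume cond: "A_torsion_condition M A D"
    show "\<forall>X\<in>VF. torsion D X (app A X) = 0"
    proof
      fix X assume "X \<in> VF"
      then have "torsion D X (app A X) = - torsion D X (app A X)"
        using cond torsion_skew[of "app A X" X] by (simp add: A_torsion_condition_def)
      then show "torsion D X (app A X) = 0"
        by (simp add: fun_eq_iff)
    qed
  next
    assume diag: "\<forall>X\<in>VF. torsion D X (app A X) = 0"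
    show "A_torsion_condition M A D"
      unfolding A_torsion_condition_def
    proof (intro ballI)
      fix X Y assume XY: "X \<in> VF" "Y \<in> VF"
      have "0 = torsion D (X + Y) (app A (X + Y))"
        using diag XY by (simp add: vf_add)
      also have "\<dots> = torsion D X (app A Y) + torsion D Y (app A X)"
        using diag XY
        by (simp add: app_add app_vf vf_add torsion_add_left torsion_add_right)
      finally show "torsion D (app A X) Y = torsion D X (app A Y)"
        using torsion_skew[of "app A X" Y] by (metis add.commute add_eq_0_iff)
    qed
  qed
  then show ?thesis
    using diagonal by simp
qed

lemma bracket_eq: "bracket X Y = D X Y - D Y X - torsion D X Y"
  by (simp add: torsion_def)

text \<open>
  Since \<open>\<omega>\<close> is parallel, the six terms \<open>\<omega> (D X Y) Z\<close> from the derivatives cancel those from the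
  brackets. The remaining cyclic sum of \<open>\<omega> (T X Y) Z\<close> gets its sign from moving \<open>A\<close> to \<open>Z\<close>.
\<close>

lemma ext_deriv_torsion:
  assumes "X \<in> VF" "Y \<in> VF" "Z \<in> VF" "p \<in> points M"
  shows "ext_deriv \<omega> X Y Z p =
    - (torsion3 g D X Y (app A Z) p + torsion3 g D Y Z (app A X) p + torsion3 g D Z X (app A Y) p)"
proof -
  have deriv: "deriv_along X (pairing \<omega> Y Z) p = pairing \<omega> (D X Y) Z p - pairing \<omega> (D X Z) Y p"
    if "X \<in> VF" "Y \<in> VF" "Z \<in> VF" for X Y Z
  proof -
    have "nabla_bilin D \<omega> X Y Z p = 0"
      using parallel_form that assms(4) by (simp add: parallel_bilin_def)
    then show ?thesis
      using pairing_form_skew[OF assms(4) connection_vf[OF that(1,3)] that(2)]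
      by (simp add: nabla_bilin_def)
  qed
  have brackets: "pairing \<omega> (bracket X Y) Z p =
      pairing \<omega> (D X Y) Z p - pairing \<omega> (D Y X) Z p + torsion3 g D X Y (app A Z) p"
    if "X \<in> VF" "Y \<in> VF" "Z \<in> VF" for X Y Z
    using that assms(4)
    by (simp add: bracket_eq pairing_form app_diff app_vf connection_vf torsion_vf vf_diff
        pairing_diff torsion3_def pairing_app_skew[of p "torsion D X Y"])
  show ?thesis
    using assms(1-3) by (simp add: ext_deriv_def deriv brackets)
qed

text \<open>
  As \<open>A\<close> commutes with \<open>D\<close>, the covariant derivatives in the four brackets cancel in pairs.
\<close>

lemma nijenhuis_torsion:
  assumes "X \<in> VF" "Y \<in> VF"
  shows "nijenhuis A X Y = app A (torsion D (app A X) Y) + app A (torsion D X (app A Y))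
    - torsion D (app A X) (app A Y) - app A (app A (torsion D X Y))"
  using assms
  by (simp add: nijenhuis_def bracket_eq connection_app app_diff app_vf connection_vf torsion_vf
      vf_diff)

lemma nijenhuis3_torsion:
  assumes "X \<in> VF" "Y \<in> VF" "Z \<in> VF" "p \<in> points M"
  shows "nijenhuis3 g A X Y Z p =
    - (torsion3 g D (app A X) Y (app A Z) p + torsion3 g D X (app A Y) (app A Z) p
      + torsion3 g D (app A X) (app A Y) Z p + torsion3 g D X Y (app A (app A Z)) p)"
  using assms
  by (simp add: nijenhuis3_def nijenhuis_torsion torsion3_def pairing_add pairing_diff
      pairing_app_skew[of p "torsion _ _ _"] pairing_app_skew[of p "app A (torsion _ _ _)"]
      vf_add vf_diff app_vf torsion_vf)

context
  assumes condition: "A_torsion_condition M A D"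
begin

lemma torsion3_app_left:
  assumes "X \<in> VF" "Y \<in> VF"
  shows "torsion3 g D X (app A Y) Z p = torsion3 g D (app A X) Y Z p"
  using condition assms by (simp add: A_torsion_condition_def torsion3_def)

text \<open>
  The condition moves \<open>A\<close> between the first two arguments; a cyclic permutation brings any other pair
  of arguments into that position.
\<close>

lemma torsion3_app_right:
  assumes "X \<in> VF" "Y \<in> VF" "Z \<in> VF" "p \<in> points M"
  shows "torsion3 g D X Y (app A Z) p = torsion3 g D (app A X) Y Z p"
proof -
  have "torsion3 g D X Y (app A Z) p = torsion3 g D Y (app A Z) X p"
    using assms by (intro torsion3_cyclic app_vf)
  also have "\<dots> = torsion3 g D (app A Y) Z X p"
    using assms by (intro torsion3_app_left)
  also have "\<dots> = torsion3 g D X (app A Y) Z p"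
    using assms by (intro torsion3_cyclic[symmetric] app_vf)
  finally show ?thesis
    using assms by (simp add: torsion3_app_left)
qed

lemma ext_deriv_eq:
  assumes "X \<in> VF" "Y \<in> VF" "Z \<in> VF" "p \<in> points M"
  shows "ext_deriv \<omega> X Y Z p = - 3 * torsion3 g D (app A X) Y Z p"
proof -
  have "torsion3 g D Y Z (app A X) p = torsion3 g D (app A X) Y Z p"
    using torsion3_cyclic[of "app A X" Y Z p] assms by (simp add: app_vf)
  moreover have "torsion3 g D Z X (app A Y) p = torsion3 g D X (app A Y) Z p"
    using torsion3_cyclic[of Z X "app A Y" p] assms by (simp add: app_vf)
  ultimately show ?thesis
    using assms by (simp add: ext_deriv_torsion torsion3_app_left torsion3_app_right)
qed

lemma nijenhuis3_eq:
  assumes "X \<in> VF" "Y \<in> VF" "Z \<in> VF" "p \<in> points M"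
  shows "nijenhuis3 g A X Y Z p = - 4 * torsion3 g D (app A (app A X)) Y Z p"
  using assms by (simp add: nijenhuis3_torsion torsion3_app_left torsion3_app_right app_vf)

end

end

theorem theorem3p4:
  fixes M :: "('m, 'e::euclidean_space) manifold"
    and g F :: "'m bilin" and A Q :: "'m endo" and D :: "'m conn"
  assumes "weak_almost_hermitian M g A Q"
    and "F = fundamental_form g A"
    and "generalized_metric_connection M (g + F) D"
    and "totally_skew M (torsion3 g D)"
  shows "(A_torsion_condition M A D \<longleftrightarrow> weak_nearly_kaehler M g A Q) \<and>
    (A_torsion_condition M A D \<longrightarrow>
      (\<forall>X\<in>vector_fields M. \<forall>Y\<in>vector_fields M. \<forall>Z\<in>vector_fields M. \<forall>p\<in>points M.
         torsion3 g D (app A X) Y Z p = - (1 / 3) * ext_deriv F X Y Z p \<and>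
         torsion3 g D (app Q X) Y Z p = (1 / 4) * nijenhuis3 g A X Y Z p \<and>
         (1 / 4) * nijenhuis3 g A X Y Z p = (1 / 3) * ext_deriv F (app A X) Y Z p))"
proof -
  interpret riemannian_skew_endo M g A
    by unfold_locales (use assms(1) in \<open>auto simp: weak_almost_hermitian_def\<close>)
  have D: "linear_connection M D" "parallel_bilin M D (g + \<omega>)"
    using assms(2,3) by (simp_all add: generalized_metric_connection_def)
  interpret skew_torsion_parallel_endo M g A D
    by unfold_locales (use D parallel_split[OF D] assms(4) in auto)
  have Q_vf: "app Q X \<in> VF" if "X \<in> VF" for X
    using assms(1) that by (simp add: weak_almost_hermitian_def endo_field_def)
  have square: "app A (app A X) = - app Q X" if "X \<in> VF" for X
  proof
    fix p show "app A (app A X) p = (- app Q X) p"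
    proof (cases "p \<in> points M")
      case True
      then show ?thesis
        using assms(1) vf_tangent[OF that] by (simp add: weak_almost_hermitian_def app_def)
    next
      case False
      then show ?thesis
        using vf_off[OF app_vf[OF app_vf[OF that]]] vf_off[OF vf_uminus[OF Q_vf[OF that]]] by simp
    qed
  qed
  have Q_torsion: "torsion3 g D (app A (app A X)) Y Z p = - torsion3 g D (app Q X) Y Z p"
    if "X \<in> VF" "Y \<in> VF" "Z \<in> VF" "p \<in> points M" for X Y Z p
  proof -
    have "torsion3 g D (- app Q X) Y Z p = - torsion3 g D Y Z (app Q X) p"
      using torsion3_cyclic[of "- app Q X" Y Z p] that
      by (simp add: vf_uminus Q_vf torsion3_def pairing_uminus torsion_vf)
    then show ?thesis
      using torsion3_cyclic[of "app Q X" Y Z p] that by (simp add: square Q_vf)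
  qed
  have "A_torsion_condition M A D \<longleftrightarrow> weak_nearly_kaehler M g A Q"
    using A_torsion_condition_iff assms(1) by (simp add: weak_nearly_kaehler_def)
  then show ?thesis
    using assms(2) by (simp add: ext_deriv_eq nijenhuis3_eq Q_torsion app_vf)
qed

end
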